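(* Let $G$ be a partially ordered group and let $C$ be a right pre-order on $G$ (identified with its pre-cone). The following are equivalent: (1) $C\in\mathscr{P}_{\mathsf A}(G)$, i.e. the $\ell$-group $H_C$ is Abelian; (2) the $\ell$-group $H_C$ is totally ordered and Abelian; (3) for every $a,b\in G$, $[a^{-1}b^{-1}ab]=[\mathrm{e}]$ in $\Omega_C$.
   Context: A partially ordered group is a group $G$ (identity $\mathrm{e}$) with a partial order such that $a\le b$ implies $sat\le sbt$; $G^+=\{a\mid a\ge \mathrm{e}\}$. An $\ell$-group is a partially ordered group whose order is a lattice; it is Abelian if its underlying group is Abelian; $\mathsf A$ is the variety of Abelian $\ell$-groups. An $\ell$-subgroup is a sublattice subgroup. A right pre-order on $G$ is a reflexive, transitive, total relation $\preceq$ on $G$, with $\preceq\ne G\times G$, extending the partial order of $G$ and such that $a\preceq b\Rightarrow at\preceq bt$. It is identified with its pre-cone $C=\{a\mid \mathrm{e}\preceq a\}$; pre-cones are exactly the proper submonoids $C\subsetneq G$ with $G=C\cup C^{-1}$ and $G^+\subseteq C$, and $a\preceq_C b$ iff $ba^{-1}\in C$. Put $a\equiv_C b$ iff $a\preceq_C b$ and $b\preceq_C a$; $\Omega_C=G/{\equiv_C}$, with classes $[a]$, is a chain with $[a]\le_C[b]$ iff $a\preceq_C b$. $\mathrm{Aut}\,\Omega_C$ is the $\ell$-group of order-preserving bijections of $\Omega_C$, where $f\cdot g$ means "$g$ after $f$" and lattice operations are pointwise. With $R_C(a)\colon[b]\mapsto[ba]$, $H_C$ is the $\ell$-subgroup of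 $\mathrm{Aut}\,\Omega_C$ generated by $R_C[G]$. $\mathscr{P}_{\mathsf A}(G)$ is the set of right pre-orders $C$ on $G$ with $H_C\in\mathsf A$. *)

theory Defs
  imports "HOL-Algebra.Bij"
begin

section \<open>Partially ordered groups and \<open>\<ell>\<close>-groups\<close>

record 'a ordered_group = "'a monoid" +
  gle :: "'a \<Rightarrow> 'a \<Rightarrow> bool" (infixl \<open>\<preceq>\<index>\<close> 50)

definition order_of :: "('a, 'm) ordered_group_scheme \<Rightarrow> 'a gorder" where
  "order_of G = \<lparr>carrier = carrier G, eq = (=), le = gle G\<rparr>"

locale po_group = group G for G (structure) +
  assumes partial_order_order_of: "partial_order (order_of G)"
    and gle_mult: "\<lbrakk>a \<in> carrier G; b \<in> carrier G; s \<in> carrier G; t \<in> carrier G; a \<preceq> b\<rbrakk>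
      \<Longrightarrow> s \<otimes> a \<otimes> t \<preceq> s \<otimes> b \<otimes> t"

definition l_group :: "('a, 'm) ordered_group_scheme \<Rightarrow> bool" where
  "l_group L \<longleftrightarrow> po_group L \<and> lattice (order_of L)"

definition abelian_l_group :: "('a, 'm) ordered_group_scheme \<Rightarrow> bool" where
  "abelian_l_group L \<longleftrightarrow> l_group L \<and> comm_group L"

definition l_subgroup :: "'a set \<Rightarrow> ('a, 'm) ordered_group_scheme \<Rightarrow> bool" where
  "l_subgroup K L \<longleftrightarrow> subgroup K L \<and>
     (\<forall>x\<in>K. \<forall>y\<in>K. x \<squnion>\<^bsub>order_of L\<^esub> y \<in> K \<and> x \<sqinter>\<^bsub>order_of L\<^esub> y \<in> K)"

definition generated_l_subgroup :: "('a, 'm) ordered_group_scheme \<Rightarrow> 'a set \<Rightarrow> 'a set" where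
  "generated_l_subgroup L S = \<Inter>{K. l_subgroup K L \<and> S \<subseteq> K}"


section \<open>Order automorphisms\<close>

text \<open>The product \<open>f \<cdot> g\<close> is ``\<open>g\<close> after \<open>f\<close>'', the opposite of the convention of
  \<^const>\<open>BijGroup\<close>. Only the (pointwise) order is recorded; that the lattice operations
  exist and are pointwise when the underlying order is total is proved below.\<close>

definition Aut :: "('a, 'm) gorder_scheme \<Rightarrow> ('a \<Rightarrow> 'a) ordered_group" where
  "Aut L =
    \<lparr>carrier = {f \<in> Bij (carrier L).
       \<forall>x\<in>carrier L. \<forall>y\<in>carrier L. x \<sqsubseteq>\<^bsub>L\<^esub> y \<longrightarrow> f x \<sqsubseteq>\<^bsub>L\<^esub> f y},
     mult = (\<lambda>f g. compose (carrier L) g f),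
     one = (\<lambda>x\<in>carrier L. x),
     gle = (\<lambda>f g. \<forall>x\<in>carrier L. f x \<sqsubseteq>\<^bsub>L\<^esub> g x)\<rparr>"


section \<open>Right pre-orders\<close>

definition right_preorder :: "('a, 'm) ordered_group_scheme \<Rightarrow> 'a rel \<Rightarrow> bool" where
  "right_preorder G P \<longleftrightarrow>
     preorder_on (carrier G) P \<and> total_on (carrier G) P \<and> P \<noteq> carrier G \<times> carrier G \<and>
     (\<forall>a\<in>carrier G. \<forall>b\<in>carrier G. a \<preceq>\<^bsub>G\<^esub> b \<longrightarrow> (a, b) \<in> P) \<and>
     (\<forall>a\<in>carrier G. \<forall>b\<in>carrier G. \<forall>t\<in>carrier G.
        (a, b) \<in> P \<longrightarrow> (a \<otimes>\<^bsub>G\<^esub> t, b \<otimes>\<^bsub>G\<^esub> t) \<in> P)"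

definition pre_cone :: "('a, 'm) ordered_group_scheme \<Rightarrow> 'a rel \<Rightarrow> 'a set" where
  "pre_cone G P = {a \<in> carrier G. (\<one>\<^bsub>G\<^esub>, a) \<in> P}"

text \<open>Right pre-orders are identified with their pre-cones: the elements of
  \<open>right_preorders G\<close> are pre-cones, and \<open>prec G C\<close> recovers the relation from the
  pre-cone \<open>C\<close>.\<close>

definition right_preorders :: "('a, 'm) ordered_group_scheme \<Rightarrow> 'a set set" where
  "right_preorders G = pre_cone G ` {P. right_preorder G P}"

definition prec :: "('a, 'm) ordered_group_scheme \<Rightarrow> 'a set \<Rightarrow> 'a rel" where
  "prec G C = {(a, b). a \<in> carrier G \<and> b \<in> carrier G \<and> b \<otimes>\<^bsub>G\<^esub> inv\<^bsub>G\<^esub> a \<in> C}"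

definition prec_equiv :: "('a, 'm) ordered_group_scheme \<Rightarrow> 'a set \<Rightarrow> 'a rel" where
  "prec_equiv G C = prec G C \<inter> (prec G C)\<inverse>"

definition cls :: "('a, 'm) ordered_group_scheme \<Rightarrow> 'a set \<Rightarrow> 'a \<Rightarrow> 'a set" where
  "cls G C a = prec_equiv G C `` {a}"

definition Omega :: "('a, 'm) ordered_group_scheme \<Rightarrow> 'a set \<Rightarrow> 'a set gorder" where
  "Omega G C =
    \<lparr>carrier = carrier G // prec_equiv G C,
     eq = (=),
     le = (\<lambda>X Y. \<exists>a\<in>X. \<exists>b\<in>Y. (a, b) \<in> prec G C)\<rparr>"

definition R_C :: "('a, 'm) ordered_group_scheme \<Rightarrow> 'a set \<Rightarrow> 'a \<Rightarrow> 'a set \<Rightarrow> 'a set" where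
  "R_C G C a = (\<lambda>X\<in>carrier (Omega G C). \<Union>b\<in>X. cls G C (b \<otimes>\<^bsub>G\<^esub> a))"

definition H_C :: "('a, 'm) ordered_group_scheme \<Rightarrow> 'a set \<Rightarrow> ('a set \<Rightarrow> 'a set) ordered_group" where
  "H_C G C = Aut (Omega G C)
     \<lparr>carrier := generated_l_subgroup (Aut (Omega G C)) (R_C G C ` carrier G)\<rparr>"

definition P_A :: "('a, 'm) ordered_group_scheme \<Rightarrow> 'a set set" where
  "P_A G = {C \<in> right_preorders G. abelian_l_group (H_C G C)}"


section \<open>The definitions behave as intended\<close>

lemma prec_pre_cone:
  fixes G (structure)
  assumes "po_group G" "right_preorder G P"
  shows "prec G (pre_cone G P) = P"
proof -
  interpret po_group G by fact
  have sub: "P \<subseteq> carrier G \<times> carrier G"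
    and tr: "\<And>a b t. \<lbrakk>a \<in> carrier G; b \<in> carrier G; t \<in> carrier G; (a, b) \<in> P\<rbrakk>
               \<Longrightarrow> (a \<otimes> t, b \<otimes> t) \<in> P"
    using assms(2) by (auto simp: right_preorder_def preorder_on_def)
  have "(\<one>, b \<otimes> inv a) \<in> P \<longleftrightarrow> (a, b) \<in> P" if "a \<in> carrier G" "b \<in> carrier G" for a b
    using tr[of \<one> "b \<otimes> inv a" a] tr[of a b "inv a"] that by (auto simp: m_assoc)
  then show ?thesis
    using sub by (auto simp: prec_def pre_cone_def)
qed

lemma right_preorders_iff:
  fixes G (structure)
  assumes "po_group G"
  shows "C \<in> right_preorders G \<longleftrightarrow>
    submonoid C G \<and> C \<noteq> carrier G \<and> carrier G = C \<union> m_inv G ` C \<and>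
    {a \<in> carrier G. \<one>\<^bsub>G\<^esub> \<preceq>\<^bsub>G\<^esub> a} \<subseteq> C"
proof -
  interpret po_group G by fact
  show ?thesis
  proof
    assume "C \<in> right_preorders G"
    then obtain P where P: "right_preorder G P" and C: "C = pre_cone G P"
      by (auto simp: right_preorders_def)
    have PC: "(a, b) \<in> P \<longleftrightarrow> b \<otimes> inv a \<in> C" if "a \<in> carrier G" "b \<in> carrier G" for a b
    proof -
      have "(a, b) \<in> P \<longleftrightarrow> (a, b) \<in> prec G C" by (simp only: C prec_pre_cone[OF assms P])
      with that show ?thesis by (simp add: prec_def)
    qed
    have sub: "C \<subseteq> carrier G" by (auto simp: C pre_cone_def)
    have Psub: "P \<subseteq> carrier G \<times> carrier G" and rfl: "\<And>a. a \<in> carrier G \<Longrightarrow> (a, a) \<in> P"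
      and tr: "trans P" and tot': "total_on (carrier G) P"
      and ne: "P \<noteq> carrier G \<times> carrier G"
      and ext: "\<And>a b. \<lbrakk>a \<in> carrier G; b \<in> carrier G; a \<preceq> b\<rbrakk> \<Longrightarrow> (a, b) \<in> P"
      and inva: "\<And>a b t. \<lbrakk>a \<in> carrier G; b \<in> carrier G; t \<in> carrier G; (a, b) \<in> P\<rbrakk>
                  \<Longrightarrow> (a \<otimes> t, b \<otimes> t) \<in> P"
      using P by (auto simp: right_preorder_def preorder_on_def refl_on_def)
    have tot: "(a, b) \<in> P \<or> (b, a) \<in> P" if "a \<in> carrier G" "b \<in> carrier G" for a b
      using tot' rfl that by (cases "a = b") (auto simp: total_on_def)
    have "submonoid C G"
    proof
      show "C \<subseteq> carrier G" by fact
      show "\<one> \<in> C" using rfl[of \<one>] by (simp add: C pre_cone_def)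
      fix x y assume xy: "x \<in> C" "y \<in> C"
      then have "(\<one>, y) \<in> P" "(y, x \<otimes> y) \<in> P"
        using inva[of \<one> x y] sub by (auto simp: C pre_cone_def)
      then show "x \<otimes> y \<in> C"
        using tr xy sub by (auto simp: C pre_cone_def dest: transD)
    qed
    moreover have "C \<noteq> carrier G"
    proof
      assume "C = carrier G"
      then have "P = carrier G \<times> carrier G" using PC Psub by auto
      with ne show False by simp
    qed
    moreover have "carrier G = C \<union> m_inv G ` C"
    proof
      show "C \<union> m_inv G ` C \<subseteq> carrier G" using sub by auto
      show "carrier G \<subseteq> C \<union> m_inv G ` C"
      proof
        fix a assume a: "a \<in> carrier G"
        then consider "a \<in> C" | "inv a \<in> C"
          using tot[of \<one> a] PC[of \<one> a] PC[of a \<one>] by auto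
        then show "a \<in> C \<union> m_inv G ` C"
        proof cases
          case 2
          have "a = inv (inv a)" using a by simp
          with 2 show ?thesis by blast
        qed simp
      qed
    qed
    moreover have "{a \<in> carrier G. \<one> \<preceq> a} \<subseteq> C"
      using ext by (auto simp: C pre_cone_def)
    ultimately show "submonoid C G \<and> C \<noteq> carrier G \<and> carrier G = C \<union> m_inv G ` C \<and>
      {a \<in> carrier G. \<one> \<preceq> a} \<subseteq> C" by blast
  next
    assume A: "submonoid C G \<and> C \<noteq> carrier G \<and> carrier G = C \<union> m_inv G ` C \<and>
      {a \<in> carrier G. \<one> \<preceq> a} \<subseteq> C"
    then interpret C: submonoid C G by simp
    have Ccar: "a \<in> C \<Longrightarrow> a \<in> carrier G" for a by (rule C.mem_carrier)
    have "pre_cone G (prec G C) = C"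
      using Ccar by (auto simp: pre_cone_def prec_def)
    moreover have "right_preorder G (prec G C)"
      unfolding right_preorder_def preorder_on_def
    proof (intro conjI ballI impI)
      show "prec G C \<subseteq> carrier G \<times> carrier G" by (auto simp: prec_def)
      show "refl_on (carrier G) (prec G C)" by (auto simp: prec_def refl_on_def)
      show "trans (prec G C)"
      proof (rule transI)
        fix x y z assume "(x, y) \<in> prec G C" "(y, z) \<in> prec G C"
        then have xyz: "x \<in> carrier G" "y \<in> carrier G" "z \<in> carrier G"
          and m: "(z \<otimes> inv y) \<otimes> (y \<otimes> inv x) \<in> C" by (auto simp: prec_def)
        have "(z \<otimes> inv y) \<otimes> (y \<otimes> inv x) = z \<otimes> inv x"
          using xyz m_assoc[of "inv y" y "inv x"] by (simp add: m_assoc)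
        with m xyz show "(x, z) \<in> prec G C" by (simp add: prec_def)
      qed
      show "total_on (carrier G) (prec G C)"
      proof (rule total_onI)
        fix x y assume xy: "x \<in> carrier G" "y \<in> carrier G"
        have "y \<otimes> inv x \<in> C \<union> m_inv G ` C" using A xy by (metis inv_closed m_closed)
        then have "y \<otimes> inv x \<in> C \<or> x \<otimes> inv y \<in> C"
          using xy Ccar inv_mult_group[of y "inv x"] by auto
        then show "(x, y) \<in> prec G C \<or> (y, x) \<in> prec G C"
          using xy by (simp add: prec_def)
      qed
      show "prec G C \<noteq> carrier G \<times> carrier G"
      proof
        assume eq: "prec G C = carrier G \<times> carrier G"
        have "a \<in> C" if "a \<in> carrier G" for a
        proof -
          have "(\<one>, a) \<in> prec G C" using eq that by simp
          then show ?thesis using that by (simp add: prec_def)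
        qed
        then show False using A Ccar by blast
      qed
    next
      fix a b assume ab: "a \<in> carrier G" "b \<in> carrier G" "a \<preceq> b"
      then have "\<one> \<preceq> b \<otimes> inv a" using gle_mult[of a b \<one> "inv a"] by simp
      then show "(a, b) \<in> prec G C" using ab A by (auto simp: prec_def)
    next
      fix a b t assume "a \<in> carrier G" "b \<in> carrier G" "t \<in> carrier G" "(a, b) \<in> prec G C"
      moreover from this have "b \<otimes> t \<otimes> inv (a \<otimes> t) = b \<otimes> inv a"
        using m_assoc[of t "inv t" "inv a"] by (simp add: inv_mult_group m_assoc)
      ultimately show "(a \<otimes> t, b \<otimes> t) \<in> prec G C" by (simp add: prec_def)
    qed
    ultimately show "C \<in> right_preorders G"
      unfolding right_preorders_def by (intro image_eqI[of _ _ "prec G C"]) simp_all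
  qed
qed

lemma right_preorder_prec:
  assumes "po_group G" "C \<in> right_preorders G"
  shows "right_preorder G (prec G C)"
  using assms prec_pre_cone by (fastforce simp: right_preorders_def)

context
  fixes G :: "('a, 'm) ordered_group_scheme" (structure) and C :: "'a set"
  assumes po: "po_group G" and C: "C \<in> right_preorders G"
begin

interpretation po_group G by (rule po)

lemma precD:
  shows "(a, b) \<in> prec G C \<Longrightarrow> a \<in> carrier G \<and> b \<in> carrier G"
    and "a \<in> carrier G \<Longrightarrow> (a, a) \<in> prec G C"
    and "(a, b) \<in> prec G C \<Longrightarrow> (b, c) \<in> prec G C \<Longrightarrow> (a, c) \<in> prec G C"
    and "a \<in> carrier G \<Longrightarrow> b \<in> carrier G \<Longrightarrow> (a, b) \<in> prec G C \<or> (b, a) \<in> prec G C"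
    and "(a, b) \<in> prec G C \<Longrightarrow> t \<in> carrier G \<Longrightarrow> (a \<otimes> t, b \<otimes> t) \<in> prec G C"
proof -
  have *: "prec G C \<subseteq> carrier G \<times> carrier G" "refl_on (carrier G) (prec G C)" "trans (prec G C)"
    "total_on (carrier G) (prec G C)"
    "\<forall>a\<in>carrier G. \<forall>b\<in>carrier G. \<forall>t\<in>carrier G.
        (a, b) \<in> prec G C \<longrightarrow> (a \<otimes> t, b \<otimes> t) \<in> prec G C"
    using right_preorder_prec[OF po C] by (auto simp: right_preorder_def preorder_on_def)
  show "(a, b) \<in> prec G C \<Longrightarrow> a \<in> carrier G \<and> b \<in> carrier G" using *(1) by auto
  show "a \<in> carrier G \<Longrightarrow> (a, a) \<in> prec G C" using *(2) by (auto simp: refl_on_def)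
  show "(a, b) \<in> prec G C \<Longrightarrow> (b, c) \<in> prec G C \<Longrightarrow> (a, c) \<in> prec G C"
    using *(3) by (auto dest: transD)
  show "a \<in> carrier G \<Longrightarrow> b \<in> carrier G \<Longrightarrow> (a, b) \<in> prec G C \<or> (b, a) \<in> prec G C"
    using *(2,4) by (cases "a = b") (auto simp: refl_on_def total_on_def)
  show "(a, b) \<in> prec G C \<Longrightarrow> t \<in> carrier G \<Longrightarrow> (a \<otimes> t, b \<otimes> t) \<in> prec G C"
    using *(1,5) by blast
qed

lemma equiv_prec_equiv: "equiv (carrier G) (prec_equiv G C)"
  unfolding prec_equiv_def
proof (rule equivI)
  show "prec G C \<inter> (prec G C)\<inverse> \<subseteq> carrier G \<times> carrier G" using precD(1) by blast
  show "refl_on (carrier G) (prec G C \<inter> (prec G C)\<inverse>)" using precD(2) by (simp add: refl_on_def)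
  show "sym (prec G C \<inter> (prec G C)\<inverse>)" by (auto simp: sym_def)
  show "trans (prec G C \<inter> (prec G C)\<inverse>)" by (rule transI) (blast intro: precD(3))
qed

lemma cls_eq_iff:
  assumes "a \<in> carrier G" "b \<in> carrier G"
  shows "cls G C a = cls G C b \<longleftrightarrow> (a, b) \<in> prec G C \<and> (b, a) \<in> prec G C"
  using eq_equiv_class_iff[OF equiv_prec_equiv assms] by (auto simp: cls_def prec_equiv_def)

lemma carrier_Omega: "carrier (Omega G C) = cls G C ` carrier G"
  by (auto simp: Omega_def cls_def quotient_def)

lemma mem_cls: "b \<in> cls G C a \<longleftrightarrow> (a, b) \<in> prec G C \<and> (b, a) \<in> prec G C"
  by (auto simp: cls_def prec_equiv_def)

lemma le_Omega_cls:
  assumes "a \<in> carrier G" "b \<in> carrier G"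
  shows "cls G C a \<sqsubseteq>\<^bsub>Omega G C\<^esub> cls G C b \<longleftrightarrow> (a, b) \<in> prec G C"
proof
  assume "cls G C a \<sqsubseteq>\<^bsub>Omega G C\<^esub> cls G C b"
  then obtain x y where "(a, x) \<in> prec G C" "(x, y) \<in> prec G C" "(y, b) \<in> prec G C"
    by (auto simp: Omega_def mem_cls)
  then show "(a, b) \<in> prec G C" using precD(3) by blast
next
  assume "(a, b) \<in> prec G C"
  moreover have "a \<in> cls G C a" "b \<in> cls G C b" using assms precD(2) by (auto simp: mem_cls)
  ultimately show "cls G C a \<sqsubseteq>\<^bsub>Omega G C\<^esub> cls G C b"
    unfolding Omega_def by auto
qed

lemma total_order_Omega: "total_order (Omega G C)"
proof -
  have [simp]: "(.=\<^bsub>Omega G C\<^esub>) = (=)" by (simp add: Omega_def)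
  show ?thesis
  proof
    fix X Y Z assume "X \<sqsubseteq>\<^bsub>Omega G C\<^esub> Y" "Y \<sqsubseteq>\<^bsub>Omega G C\<^esub> Z" "X \<in> carrier (Omega G C)"
      "Y \<in> carrier (Omega G C)" "Z \<in> carrier (Omega G C)"
    then show "X \<sqsubseteq>\<^bsub>Omega G C\<^esub> Z"
      by (auto simp: carrier_Omega le_Omega_cls intro: precD(3))
  next
    fix X Y assume "X \<in> carrier (Omega G C)" "Y \<in> carrier (Omega G C)"
    then show "X \<sqsubseteq>\<^bsub>Omega G C\<^esub> Y \<or> Y \<sqsubseteq>\<^bsub>Omega G C\<^esub> X"
      by (auto simp: carrier_Omega le_Omega_cls dest: precD(4))
  next
    fix X Y assume *: "X \<sqsubseteq>\<^bsub>Omega G C\<^esub> Y" "Y \<sqsubseteq>\<^bsub>Omega G C\<^esub> X"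
      and "X \<in> carrier (Omega G C)" "Y \<in> carrier (Omega G C)"
    then obtain a b where "a \<in> carrier G" "b \<in> carrier G" "X = cls G C a" "Y = cls G C b"
      by (auto simp: carrier_Omega)
    with * have "X = Y" by (simp add: cls_eq_iff le_Omega_cls)
    then show "X .=\<^bsub>Omega G C\<^esub> Y" by simp
  qed (auto simp: carrier_Omega le_Omega_cls precD(2))
qed

lemma R_C_cls:
  assumes "a \<in> carrier G" "b \<in> carrier G"
  shows "R_C G C a (cls G C b) = cls G C (b \<otimes> a)"
proof -
  have "cls G C (x \<otimes> a) = cls G C (b \<otimes> a)" if "x \<in> cls G C b" for x
  proof -
    have "(b, x) \<in> prec G C" "(x, b) \<in> prec G C" using that by (auto simp: mem_cls)
    moreover from this have "x \<in> carrier G" using precD(1) by blast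
    ultimately show ?thesis
      using assms by (subst cls_eq_iff) (simp_all add: precD(5))
  qed
  moreover have "b \<in> cls G C b" using assms precD(2) by (simp add: mem_cls)
  ultimately have "(\<Union>x\<in>cls G C b. cls G C (x \<otimes> a)) = cls G C (b \<otimes> a)" by blast
  then show ?thesis using assms by (simp add: R_C_def carrier_Omega)
qed

lemma R_C_in_Aut:
  assumes a: "a \<in> carrier G"
  shows "R_C G C a \<in> carrier (Aut (Omega G C))"
proof -
  have 1: "R_C G C x (R_C G C y (cls G C b)) = cls G C (b \<otimes> y \<otimes> x)"
    if "x \<in> carrier G" "y \<in> carrier G" "b \<in> carrier G" for x y b
    using that by (simp add: R_C_cls)
  have 2: "b \<otimes> inv a \<otimes> a = b" "b \<otimes> a \<otimes> inv a = b" if "b \<in> carrier G" for b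
    using that a by (simp_all add: m_assoc)
  have "bij_betw (R_C G C a) (carrier (Omega G C)) (carrier (Omega G C))"
    by (rule bij_betw_byWitness[where f' = "R_C G C (inv a)"])
      (use a in \<open>auto simp: carrier_Omega 1 2 R_C_cls\<close>)
  moreover have "R_C G C a \<in> extensional (carrier (Omega G C))" by (simp add: R_C_def)
  ultimately show ?thesis
    using a by (auto simp: Aut_def Bij_def carrier_Omega R_C_cls le_Omega_cls precD(5))
qed

end

lemma (in total_order) group_Aut: "group (Aut L)"
proof (rule groupI)
  fix f g assume fg: "f \<in> carrier (Aut L)" "g \<in> carrier (Aut L)"
  then have "f x \<in> carrier L" if "x \<in> carrier L" for x
    using that by (auto simp: Aut_def Bij_def dest: bij_betwE)
  with fg have "compose (carrier L) g f x \<sqsubseteq> compose (carrier L) g f y"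
    if "x \<in> carrier L" "y \<in> carrier L" "x \<sqsubseteq> y" for x y
    using that by (simp add: Aut_def compose_def)
  with fg show "f \<otimes>\<^bsub>Aut L\<^esub> g \<in> carrier (Aut L)"
    by (simp add: Aut_def compose_Bij)
  fix h assume "h \<in> carrier (Aut L)"
  with fg show "f \<otimes>\<^bsub>Aut L\<^esub> g \<otimes>\<^bsub>Aut L\<^esub> h = f \<otimes>\<^bsub>Aut L\<^esub> (g \<otimes>\<^bsub>Aut L\<^esub> h)"
    using compose_assoc[of f "carrier L" "carrier L" h g] by (simp add: Aut_def Bij_imp_funcset)
next
  show "\<one>\<^bsub>Aut L\<^esub> \<in> carrier (Aut L)" by (simp add: Aut_def id_Bij)
next
  fix f assume f: "f \<in> carrier (Aut L)"
  then show "\<one>\<^bsub>Aut L\<^esub> \<otimes>\<^bsub>Aut L\<^esub> f = f"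
    by (auto simp: Aut_def Bij_def compose_def extensional_def)
  let ?g = "restrict (inv_into (carrier L) f) (carrier L)"
  have B: "f \<in> Bij (carrier L)"
    and mono: "\<And>x y. \<lbrakk>x \<in> carrier L; y \<in> carrier L; x \<sqsubseteq> y\<rbrakk> \<Longrightarrow> f x \<sqsubseteq> f y"
    using f by (auto simp: Aut_def)
  have im: "f ` carrier L = carrier L" using B by (simp add: Bij_def bij_betw_def)
  have gm: "?g x \<in> carrier L" "f (?g x) = x" if "x \<in> carrier L" for x
    using that im by (auto intro: inv_into_into f_inv_into_f)
  have "?g x \<sqsubseteq> ?g y" if "x \<in> carrier L" "y \<in> carrier L" "x \<sqsubseteq> y" for x y
  proof (rule ccontr)
    assume n: "\<not> ?g x \<sqsubseteq> ?g y"
    then have "?g y \<sqsubseteq> ?g x" using total_order_total[of "?g x" "?g y"] gm that by blast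
    then have "y \<sqsubseteq> x" using mono[of "?g y" "?g x"] gm that by metis
    then have "x = y" using that le_antisym by blast
    then show False using n gm that le_refl by blast
  qed
  then have "?g \<in> carrier (Aut L)" using restrict_inv_into_Bij[OF B] by (simp add: Aut_def)
  moreover have "compose (carrier L) f ?g = (\<lambda>x\<in>carrier L. x)"
    using gm(2) by (auto simp: compose_def)
  ultimately show "\<exists>g\<in>carrier (Aut L). g \<otimes>\<^bsub>Aut L\<^esub> f = \<one>\<^bsub>Aut L\<^esub>"
    by (intro bexI[of _ ?g]) (simp_all add: Aut_def)
qed

lemma (in total_order) po_group_Aut: "po_group (Aut L)"
proof -
  interpret A: group "Aut L" by (rule group_Aut)
  have car: "f x \<in> carrier L" if "f \<in> carrier (Aut L)" "x \<in> carrier L" for f x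
    using that by (auto simp: Aut_def Bij_def dest: bij_betwE)
  have ext: "f = g" if "f \<in> carrier (Aut L)" "g \<in> carrier (Aut L)"
    "\<And>x. x \<in> carrier L \<Longrightarrow> f x = g x" for f g
    using that by (intro extensionalityI[of f "carrier L" g]) (simp_all add: Aut_def Bij_def)
  show ?thesis
  proof (intro po_group.intro po_group_axioms.intro group_Aut)
    have [simp]: "(.=\<^bsub>order_of (Aut L)\<^esub>) = (=)" "carrier (order_of (Aut L)) = carrier (Aut L)"
      "f \<sqsubseteq>\<^bsub>order_of (Aut L)\<^esub> g \<longleftrightarrow> (\<forall>x\<in>carrier L. f x \<sqsubseteq> g x)" for f g
      by (simp_all add: order_of_def Aut_def)
    show "partial_order (order_of (Aut L))"
    proof
      fix f g assume fg: "f \<sqsubseteq>\<^bsub>order_of (Aut L)\<^esub> g" "g \<sqsubseteq>\<^bsub>order_of (Aut L)\<^esub> f"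
        "f \<in> carrier (order_of (Aut L))" "g \<in> carrier (order_of (Aut L))"
      then have "f x = g x" if "x \<in> carrier L" for x
        using that by (intro le_antisym) (simp_all add: car)
      with fg show "f .=\<^bsub>order_of (Aut L)\<^esub> g" by (simp add: ext)
    next
      fix f g h assume fgh: "f \<sqsubseteq>\<^bsub>order_of (Aut L)\<^esub> g" "g \<sqsubseteq>\<^bsub>order_of (Aut L)\<^esub> h"
        "f \<in> carrier (order_of (Aut L))" "g \<in> carrier (order_of (Aut L))"
        "h \<in> carrier (order_of (Aut L))"
      then have "f x \<sqsubseteq> h x" if "x \<in> carrier L" for x
        using that by (intro le_trans[of "f x" "g x" "h x"]) (simp_all add: car)
      then show "f \<sqsubseteq>\<^bsub>order_of (Aut L)\<^esub> h" by simp
    qed (simp_all add: car)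
    fix f g s t assume A: "f \<in> carrier (Aut L)" "g \<in> carrier (Aut L)"
      "s \<in> carrier (Aut L)" "t \<in> carrier (Aut L)" "f \<preceq>\<^bsub>Aut L\<^esub> g"
    have m: "t y \<sqsubseteq> t z" if "y \<in> carrier L" "z \<in> carrier L" "y \<sqsubseteq> z" for y z
      using A(4) that by (simp add: Aut_def)
    have "f x \<sqsubseteq> g x" if "x \<in> carrier L" for x using A(5) that by (simp add: Aut_def)
    then have "t (f (s x)) \<sqsubseteq> t (g (s x))" if "x \<in> carrier L" for x
      using that A by (intro m) (simp_all add: car)
    then show "s \<otimes>\<^bsub>Aut L\<^esub> f \<otimes>\<^bsub>Aut L\<^esub> t \<preceq>\<^bsub>Aut L\<^esub> s \<otimes>\<^bsub>Aut L\<^esub> g \<otimes>\<^bsub>Aut L\<^esub> t"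
      using A car by (simp add: Aut_def compose_def)
  qed
qed

lemma (in total_order) join_cases:
  assumes "x \<in> carrier L" "y \<in> carrier L"
  shows "x \<sqsubseteq> y \<Longrightarrow> x \<squnion> y = y" "x \<sqsubseteq> y \<Longrightarrow> y \<squnion> x = y" "x \<sqsubseteq> y \<Longrightarrow> x \<sqinter> y = x" "x \<sqsubseteq> y \<Longrightarrow> y \<sqinter> x = x"
  using assms
  by (auto intro!: le_antisym join_le meet_le join_left join_right meet_left meet_right)

lemma (in total_order) dual_total_order: "total_order (inv_gorder L)"
proof -
  interpret d: partial_order "inv_gorder L" by (rule dual_order)
  show ?thesis
    using total_order_total by unfold_locales auto
qed

lemma (in total_order) pointwise_join_in_Aut:
  assumes f: "f \<in> carrier (Aut L)" and g: "g \<in> carrier (Aut L)"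
  shows "(\<lambda>x\<in>carrier L. f x \<squnion> g x) \<in> carrier (Aut L)"
proof -
  let ?h = "\<lambda>x\<in>carrier L. f x \<squnion> g x"
  have car: "f x \<in> carrier L" "g x \<in> carrier L" if "x \<in> carrier L" for x
    using f g that by (auto simp: Aut_def Bij_def dest: bij_betwE)
  have fmono: "f x \<sqsubseteq> f y" and gmono: "g x \<sqsubseteq> g y"
    if "x \<in> carrier L" "y \<in> carrier L" "x \<sqsubseteq> y" for x y
    using f g that by (auto simp: Aut_def)
  have inj: "inj_on f (carrier L)" "inj_on g (carrier L)"
    and im: "f ` carrier L = carrier L" "g ` carrier L = carrier L"
    using f g by (auto simp: Aut_def Bij_def bij_betw_def)
  have hmono: "?h x \<sqsubseteq> ?h y" if xy: "x \<in> carrier L" "y \<in> carrier L" "x \<sqsubseteq> y" for x y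
  proof -
    have "f x \<sqsubseteq> f y \<squnion> g y"
      by (rule le_trans[OF fmono[OF xy] join_left]) (simp_all add: car xy)
    moreover have "g x \<sqsubseteq> f y \<squnion> g y"
      by (rule le_trans[OF gmono[OF xy] join_right]) (simp_all add: car xy)
    ultimately show ?thesis using xy by (simp add: join_le car)
  qed
  have hne: "x = y" if xy: "x \<in> carrier L" "y \<in> carrier L" "x \<sqsubseteq> y" and eq: "?h x = ?h y" for x y
  proof (cases "f y \<sqsubseteq> g y")
    case True
    then have "?h y = g y" using xy by (simp add: join_cases car)
    with eq xy have e: "g y = f x \<squnion> g x" by simp
    consider "f x \<squnion> g x = g x" | "g x \<sqsubseteq> f x" "f x \<squnion> g x = f x"
      using total_order_total[of "f x" "g x"] xy car join_cases by metis
    then show ?thesis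
    proof cases
      case 1
      with e show ?thesis using inj(2) xy by (simp add: inj_on_def)
    next
      case 2
      with e True have "f y \<sqsubseteq> f x" by simp
      then have "f x = f y" using fmono[OF xy] le_antisym[of "f x" "f y"] xy car by simp
      then show ?thesis using inj(1) xy by (simp add: inj_on_def)
    qed
  next
    case False
    then have le: "g y \<sqsubseteq> f y" using total_order_total[of "f y" "g y"] xy car by simp
    then have "?h y = f y" using xy by (simp add: join_cases car)
    with eq xy have e: "f y = f x \<squnion> g x" by simp
    consider "f x \<squnion> g x = f x" | "f x \<sqsubseteq> g x" "f x \<squnion> g x = g x"
      using total_order_total[of "f x" "g x"] xy car join_cases by metis
    then show ?thesis
    proof cases
      case 1
      with e show ?thesis using inj(1) xy by (simp add: inj_on_def)
    next
      case 2
      with e le have "g y \<sqsubseteq> g x" by simp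
      then have "g x = g y" using gmono[OF xy] le_antisym[of "g x" "g y"] xy car by simp
      then show ?thesis using inj(2) xy by (simp add: inj_on_def)
    qed
  qed
  have "inj_on ?h (carrier L)"
  proof (rule inj_onI)
    fix x y assume "x \<in> carrier L" "y \<in> carrier L" "?h x = ?h y"
    then show "x = y" using hne[of x y] hne[of y x] total_order_total[of x y] by metis
  qed
  moreover have "?h ` carrier L = carrier L"
  proof
    show "?h ` carrier L \<subseteq> carrier L" using car by auto
    show "carrier L \<subseteq> ?h ` carrier L"
    proof
      fix y assume y: "y \<in> carrier L"
      then obtain u v where uv: "u \<in> carrier L" "v \<in> carrier L" "f u = y" "g v = y"
        using im by (metis imageE)
      show "y \<in> ?h ` carrier L"
      proof (cases "u \<sqsubseteq> v")
        case True
        then have "g u \<sqsubseteq> f u" using gmono[of u v] uv by simp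
        then have "?h u = y" using uv y car by (simp add: join_cases)
        then show ?thesis using uv by blast
      next
        case False
        then have "v \<sqsubseteq> u" using total_order_total[of u v] uv by simp
        then have "f v \<sqsubseteq> g v" using fmono[of v u] uv by simp
        then have "?h v = y" using uv y car by (simp add: join_cases)
        then show ?thesis using uv by blast
      qed
    qed
  qed
  ultimately have "?h \<in> Bij (carrier L)" by (simp add: Bij_def bij_betw_def)
  with hmono show ?thesis by (simp add: Aut_def)
qed

lemma (in total_order) pointwise_meet_in_Aut:
  assumes "f \<in> carrier (Aut L)" "g \<in> carrier (Aut L)"
  shows "(\<lambda>x\<in>carrier L. f x \<sqinter> g x) \<in> carrier (Aut L)"
proof -
  have "carrier (Aut (inv_gorder L)) = carrier (Aut L)" by (auto simp: Aut_def)
  then show ?thesis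
    using total_order.pointwise_join_in_Aut[OF dual_total_order, of f g] assms by simp
qed

lemma (in total_order) l_group_Aut: "l_group (Aut L)"
  and join_Aut: "\<lbrakk>f \<in> carrier (Aut L); g \<in> carrier (Aut L)\<rbrakk> \<Longrightarrow>
      f \<squnion>\<^bsub>order_of (Aut L)\<^esub> g = (\<lambda>x\<in>carrier L. f x \<squnion> g x)"
  and meet_Aut: "\<lbrakk>f \<in> carrier (Aut L); g \<in> carrier (Aut L)\<rbrakk> \<Longrightarrow>
      f \<sqinter>\<^bsub>order_of (Aut L)\<^esub> g = (\<lambda>x\<in>carrier L. f x \<sqinter> g x)"
proof -
  let ?A = "order_of (Aut L)"
  interpret A: po_group "Aut L" by (rule po_group_Aut)
  interpret A: partial_order ?A by (rule A.partial_order_order_of)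
  have cA: "carrier ?A = carrier (Aut L)"
    and leA: "\<And>f g. f \<sqsubseteq>\<^bsub>?A\<^esub> g \<longleftrightarrow> (\<forall>x\<in>carrier L. f x \<sqsubseteq> g x)"
    by (simp_all add: order_of_def Aut_def)
  have car: "f x \<in> carrier L" if "f \<in> carrier (Aut L)" "x \<in> carrier L" for f x
    using that by (auto simp: Aut_def Bij_def dest: bij_betwE)
  have J: "least ?A (\<lambda>x\<in>carrier L. f x \<squnion> g x) (Upper ?A {f, g})"
    if "f \<in> carrier (Aut L)" "g \<in> carrier (Aut L)" for f g
    using that pointwise_join_in_Aut[OF that]
    by (intro least_UpperI)
       (auto simp: cA leA car Upper_def intro!: join_left join_right join_le)
  have M: "greatest ?A (\<lambda>x\<in>carrier L. f x \<sqinter> g x) (Lower ?A {f, g})"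
    if "f \<in> carrier (Aut L)" "g \<in> carrier (Aut L)" for f g
    using that pointwise_meet_in_Aut[OF that]
    by (intro greatest_LowerI)
       (auto simp: cA leA car Lower_def intro!: meet_left meet_right meet_le)
  have "lattice ?A"
  proof
    fix f g assume fg: "f \<in> carrier ?A" "g \<in> carrier ?A"
    show "\<exists>s. least ?A s (Upper ?A {f, g})"
      by (rule exI, rule J) (use fg in \<open>simp_all add: cA\<close>)
    show "\<exists>s. greatest ?A s (Lower ?A {f, g})"
      by (rule exI, rule M) (use fg in \<open>simp_all add: cA\<close>)
  qed
  then show "l_group (Aut L)" by (simp add: l_group_def po_group_Aut)
  interpret AL: lattice ?A by fact
  show "f \<squnion>\<^bsub>?A\<^esub> g = (\<lambda>x\<in>carrier L. f x \<squnion> g x)"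
    if fg: "f \<in> carrier (Aut L)" "g \<in> carrier (Aut L)"
    unfolding join_def[of ?A] using AL.sup_of_two_least[of f g] fg
    by (intro A.least_unique[OF _ J[OF fg]]) (simp_all add: cA)
  show "f \<sqinter>\<^bsub>?A\<^esub> g = (\<lambda>x\<in>carrier L. f x \<sqinter> g x)"
    if fg: "f \<in> carrier (Aut L)" "g \<in> carrier (Aut L)"
    unfolding meet_def[of ?A] using AL.inf_of_two_greatest[of f g] fg
    by (intro A.greatest_unique[OF _ M[OF fg]]) (simp_all add: cA)
qed

end

theory Submission
  imports Defs
begin

text \<open>Write \<open>E\<close> for the subgroup \<open>{x. [x] = [e]}\<close>, so that the class of \<open>x\<close> is the coset \<open>E x\<close>.
  Evaluating two commuting translations at \<open>[a\<^sup>-\<^sup>1b\<^sup>-\<^sup>1]\<close> puts all commutators into \<open>E\<close>.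
  Conversely, if \<open>E\<close> contains all commutators, then \<open>[ca] = [ac]\<close>, so that right translations
  commute and, by right invariance of the order, are compared by their values at \<open>[e]\<close>.
  Thus \<open>R_C[G]\<close> is a chain, hence closed under the lattice operations, and equals \<open>H_C\<close>.\<close>

lemma (in po_group) po_group_subgroup:
  assumes "subgroup K G"
  shows "po_group (G\<lparr>carrier := K\<rparr>)"
proof -
  interpret K: subgroup K G by fact
  interpret P: partial_order "order_of G" by (rule partial_order_order_of)
  have P: "carrier (order_of G) = carrier G" "(.=\<^bsub>order_of G\<^esub>) = (=)"
    "x \<sqsubseteq>\<^bsub>order_of G\<^esub> y \<longleftrightarrow> x \<preceq> y" for x y
    by (simp_all add: order_of_def)
  show ?thesis
  proof (intro po_group.intro po_group_axioms.intro subgroup_imp_group assms)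
    show "partial_order (order_of (G\<lparr>carrier := K\<rparr>))"
      using P.le_refl P.le_trans P.le_antisym
      by unfold_locales (auto simp: P order_of_def dest: K.mem_carrier)
  qed (simp add: gle_mult)
qed

text \<open>Of two comparable elements one is the join and the other the meet, so closure under the
  lattice operations is automatic, even if \<open>L\<close> itself is not a chain.\<close>

lemma l_subgroup_if_chain:
  fixes L (structure)
  assumes "l_group L" and K: "subgroup K L"
    and chain: "\<And>x y. \<lbrakk>x \<in> K; y \<in> K\<rbrakk> \<Longrightarrow> x \<preceq> y \<or> y \<preceq> x"
  shows "l_subgroup K L"
proof -
  interpret P: lattice "order_of L" using assms(1) by (simp add: l_group_def)
  have "x \<squnion>\<^bsub>order_of L\<^esub> y \<in> {x, y} \<and> x \<sqinter>\<^bsub>order_of L\<^esub> y \<in> {x, y}"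
    if xy: "x \<in> K" "y \<in> K" for x y
  proof -
    have car: "x \<in> carrier (order_of L)" "y \<in> carrier (order_of L)"
      using xy subgroup.subset[OF K] by (auto simp: order_of_def)
    have "x \<sqsubseteq>\<^bsub>order_of L\<^esub> y \<or> y \<sqsubseteq>\<^bsub>order_of L\<^esub> x"
      using chain[OF xy] by (simp add: order_of_def)
    then show ?thesis
    proof
      assume "x \<sqsubseteq>\<^bsub>order_of L\<^esub> y"
      then have "x \<squnion>\<^bsub>order_of L\<^esub> y = y" "x = x \<sqinter>\<^bsub>order_of L\<^esub> y"
        using P.le_iff_meet P.le_iff_join car by blast+
      then show ?thesis by simp
    next
      assume "y \<sqsubseteq>\<^bsub>order_of L\<^esub> x"
      then have "y \<squnion>\<^bsub>order_of L\<^esub> x = x" "y = y \<sqinter>\<^bsub>order_of L\<^esub> x"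
        using P.le_iff_meet P.le_iff_join car by blast+
      then show ?thesis by (simp add: join_comm[of _ x y] meet_comm[of _ x y])
    qed
  qed
  then show ?thesis using K unfolding l_subgroup_def by (metis insert_iff singletonD)
qed

lemma total_order_if_chain:
  fixes L (structure)
  assumes "po_group L"
    and "\<And>x y. \<lbrakk>x \<in> carrier L; y \<in> carrier L\<rbrakk> \<Longrightarrow> x \<preceq> y \<or> y \<preceq> x"
  shows "total_order (order_of L)"
  using assms
  by (intro partial_order.total_orderI po_group.partial_order_order_of) (auto simp: order_of_def)

lemma l_group_if_total_order:
  assumes "po_group L" "total_order (order_of L)"
  shows "l_group L"
proof -
  interpret total_order "order_of L" by fact
  show ?thesis using assms(1) lattice_axioms by (simp add: l_group_def)
qed

lemma generated_l_subgroup_incl: "S \<subseteq> generated_l_subgroup L S"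
  by (auto simp: generated_l_subgroup_def)

lemma generated_l_subgroup_eq: "l_subgroup K L \<Longrightarrow> generated_l_subgroup L K = K"
  by (auto simp: generated_l_subgroup_def)

context
  fixes G :: "('a, 'm) ordered_group_scheme" (structure) and C :: "'a set"
  assumes po: "po_group G" and C: "C \<in> right_preorders G"
begin

interpretation po_group G by (rule po)
interpretation Om: total_order "Omega G C" by (rule total_order_Omega[OF po C])
interpretation A: group "Aut (Omega G C)" by (rule Om.group_Aut)

text \<open>Right multiplication by \<open>t\<close> descends to classes as the map
  \<open>R_C G C t\<close>, and a map takes equal arguments to equal values.\<close>

lemma cls_mult_right:
  assumes "a \<in> carrier G" "b \<in> carrier G" "t \<in> carrier G" "cls G C a = cls G C b"
  shows "cls G C (a \<otimes> t) = cls G C (b \<otimes> t)"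
  using assms R_C_cls[OF po C, of t] by metis

text \<open>Since the second factor of a product in \<open>Aut\<close> acts last, a class
  \<open>[c]\<close> travels to \<open>[ca]\<close> and then to \<open>[cab]\<close>. Hence
  translation is a homomorphism and not an anti-homomorphism.\<close>

lemma R_C_mult:
  assumes "a \<in> carrier G" "b \<in> carrier G"
  shows "R_C G C a \<otimes>\<^bsub>Aut (Omega G C)\<^esub> R_C G C b = R_C G C (a \<otimes> b)"
proof
  fix X
  show "(R_C G C a \<otimes>\<^bsub>Aut (Omega G C)\<^esub> R_C G C b) X = R_C G C (a \<otimes> b) X"
  proof (cases "X \<in> carrier (Omega G C)")
    case True
    then obtain c where "c \<in> carrier G" "X = cls G C c"
      by (auto simp: carrier_Omega[OF po C])
    with True assms show ?thesis
      by (simp add: Aut_def compose_def R_C_cls[OF po C] m_assoc)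
  \<comment> \<open>Off the carrier both sides are \<open>undefined\<close>.\<close>
  qed (simp add: Aut_def compose_def R_C_def)
qed

lemma subgroup_range_R_C: "subgroup (R_C G C ` carrier G) (Aut (Omega G C))"
proof -
  interpret h: group_hom G "Aut (Omega G C)" "R_C G C"
    by unfold_locales (auto simp: hom_def R_C_mult R_C_in_Aut[OF po C])
  show ?thesis by (rule h.img_is_subgroup)
qed

lemma R_C_le_iff:
  assumes ab: "a \<in> carrier G" "b \<in> carrier G"
  shows "R_C G C a \<preceq>\<^bsub>Aut (Omega G C)\<^esub> R_C G C b \<longleftrightarrow>
    (\<forall>c\<in>carrier G. cls G C (c \<otimes> a) \<sqsubseteq>\<^bsub>Omega G C\<^esub> cls G C (c \<otimes> b))"
  using ab by (simp add: Aut_def carrier_Omega[OF po C] R_C_cls[OF po C])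

lemma abelian_imp_cls_commutator:
  assumes "abelian_l_group (H_C G C)" and ab: "a \<in> carrier G" "b \<in> carrier G"
  shows "cls G C (inv a \<otimes> inv b \<otimes> a \<otimes> b) = cls G C \<one>"
proof -
  have "R_C G C x \<in> carrier (H_C G C)" if "x \<in> carrier G" for x
    using that generated_l_subgroup_incl[of "R_C G C ` carrier G" "Aut (Omega G C)"]
    by (auto simp: H_C_def)
  then have "R_C G C a \<otimes>\<^bsub>H_C G C\<^esub> R_C G C b = R_C G C b \<otimes>\<^bsub>H_C G C\<^esub> R_C G C a"
    using assms by (intro comm_groupE(4)) (simp_all add: abelian_l_group_def)
  then have "R_C G C (a \<otimes> b) = R_C G C (b \<otimes> a)"
    using ab by (simp add: H_C_def R_C_mult)
  \<comment> \<open>The evaluation point is the class of the inverse of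
    \<open>b \<otimes> a\<close>, so the right-hand side becomes the class of the identity.\<close>
  then have "cls G C (inv a \<otimes> inv b \<otimes> (a \<otimes> b)) = cls G C (inv a \<otimes> inv b \<otimes> (b \<otimes> a))"
    using ab R_C_cls[OF po C] by (metis inv_closed m_closed)
  moreover have "inv a \<otimes> inv b \<otimes> (b \<otimes> a) = \<one>"
    using ab by (metis inv_mult_group l_inv m_closed)
  ultimately show ?thesis using ab by (simp add: m_assoc)
qed

text \<open>Equality of classes is known to survive multiplication on the right only, so the
  commutator has to be split off on the left: it is the one of \<open>inv a\<close> and
  \<open>inv b\<close>, multiplied by \<open>b \<otimes> a\<close>.\<close>

lemma cls_commute:
  assumes comm: "\<And>a b. \<lbrakk>a \<in> carrier G; b \<in> carrier G\<rbrakk> \<Longrightarrow>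
      cls G C (inv a \<otimes> inv b \<otimes> a \<otimes> b) = cls G C \<one>"
    and ab: "a \<in> carrier G" "b \<in> carrier G"
  shows "cls G C (a \<otimes> b) = cls G C (b \<otimes> a)"
proof -
  have "cls G C (a \<otimes> b \<otimes> inv a \<otimes> inv b \<otimes> (b \<otimes> a)) = cls G C (\<one> \<otimes> (b \<otimes> a))"
    using comm[of "inv a" "inv b"] ab by (intro cls_mult_right) simp_all
  moreover have "a \<otimes> b \<otimes> inv a \<otimes> inv b \<otimes> (b \<otimes> a) = a \<otimes> b"
    using ab by (simp add: m_assoc inv_solve_left')
  ultimately show ?thesis using ab by simp
qed

lemma cls_commutator_imp_abelian_chain:
  assumes comm: "\<And>a b. \<lbrakk>a \<in> carrier G; b \<in> carrier G\<rbrakk> \<Longrightarrow>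
      cls G C (inv a \<otimes> inv b \<otimes> a \<otimes> b) = cls G C \<one>"
  shows "total_order (order_of (H_C G C)) \<and> abelian_l_group (H_C G C)"
proof -
  let ?R = "R_C G C ` carrier G"
  have "R_C G C a \<preceq>\<^bsub>Aut (Omega G C)\<^esub> R_C G C b"
    if "a \<in> carrier G" "b \<in> carrier G" "(a, b) \<in> prec G C" for a b
    unfolding R_C_le_iff[OF that(1,2)]
  proof
    fix c assume c: "c \<in> carrier G"
    \<comment> \<open>The order is invariant on the right, whereas translations put \<open>c\<close>
      on the left; commuting inside the classes moves it across.\<close>
    have "cls G C (a \<otimes> c) \<sqsubseteq>\<^bsub>Omega G C\<^esub> cls G C (b \<otimes> c)"
      using that c by (simp add: le_Omega_cls[OF po C] precD(5)[OF po C])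
    then show "cls G C (c \<otimes> a) \<sqsubseteq>\<^bsub>Omega G C\<^esub> cls G C (c \<otimes> b)"
      using cls_commute[OF comm that(1) c] cls_commute[OF comm that(2) c] by metis
  qed
  then have chain: "x \<preceq>\<^bsub>Aut (Omega G C)\<^esub> y \<or> y \<preceq>\<^bsub>Aut (Omega G C)\<^esub> x"
    if "x \<in> ?R" "y \<in> ?R" for x y
    using that precD(4)[OF po C] by blast
  \<comment> \<open>The translations already form an \<open>l_subgroup\<close>, so generating adds
    nothing.\<close>
  have H: "H_C G C = Aut (Omega G C)\<lparr>carrier := ?R\<rparr>"
    using generated_l_subgroup_eq[OF l_subgroup_if_chain[OF Om.l_group_Aut subgroup_range_R_C chain]]
    by (simp add: H_C_def)
  have poH: "po_group (H_C G C)"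
    unfolding H by (rule po_group.po_group_subgroup[OF Om.po_group_Aut subgroup_range_R_C])
  have total: "total_order (order_of (H_C G C))"
    using chain by (intro total_order_if_chain poH) (auto simp: H)
  have commR: "R_C G C (a \<otimes> b) = R_C G C (b \<otimes> a)" if ab: "a \<in> carrier G" "b \<in> carrier G" for a b
  proof
    fix X
    show "R_C G C (a \<otimes> b) X = R_C G C (b \<otimes> a) X"
    proof (cases "X \<in> carrier (Omega G C)")
      case True
      then obtain c where c: "c \<in> carrier G" "X = cls G C c"
        by (auto simp: carrier_Omega[OF po C])
      \<comment> \<open>The factor \<open>c\<close> is moved to the right, where the swap of
        \<open>a\<close> and \<open>b\<close> is compatible with it, and then moved back.\<close>
      have "cls G C (c \<otimes> (a \<otimes> b)) = cls G C (a \<otimes> b \<otimes> c)"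
        using ab c by (intro cls_commute[OF comm]) simp_all
      also have "\<dots> = cls G C (b \<otimes> a \<otimes> c)"
        using ab c by (intro cls_mult_right cls_commute[OF comm]) simp_all
      also have "\<dots> = cls G C (c \<otimes> (b \<otimes> a))"
        using ab c by (intro cls_commute[OF comm]) simp_all
      finally show ?thesis using ab c by (simp add: R_C_cls[OF po C])
    qed (simp add: R_C_def)
  qed
  have "comm_group (H_C G C)"
    using po_group.axioms(1)[OF poH]
    by (rule group.group_comm_groupI) (auto simp: H R_C_mult commR)
  with total poH show ?thesis
    by (simp add: abelian_l_group_def l_group_if_total_order)
qed

end

theorem theorem6p2:
  fixes G :: "('a, 'm) ordered_group_scheme" (structure) and C :: "'a set"
  assumes "po_group G" and "C \<in> right_preorders G"
  shows "(C \<in> P_A G \<longleftrightarrow> total_order (order_of (H_C G C)) \<and> abelian_l_group (H_C G C)) \<and>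
         (C \<in> P_A G \<longleftrightarrow>
           (\<forall>a\<in>carrier G. \<forall>b\<in>carrier G. cls G C (inv a \<otimes> inv b \<otimes> a \<otimes> b) = cls G C \<one>))"
  \<comment> \<open>The implications form a cycle: Abelian gives trivial commutator classes, these
    give a totally ordered Abelian group, and forgetting totality returns to the start.\<close>
  using abelian_imp_cls_commutator[OF assms] cls_commutator_imp_abelian_chain[OF assms] assms(2)
  unfolding P_A_def by blast

end
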